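(* Let $P$ be a poset and $\prec$ a pre-approximating auxiliary relation on $P$, and let $P_{\mu^\prec}=(P,\mu^\prec(P))$. (1) If $P_{\mu^\prec}$ is a c-space, then $\prec$ is approximating. (2) If $\prec$ satisfies the interpolation property (for all $x,z$, $x\prec z$ implies there is $y$ with $x\prec y\prec z$), then $P_{\mu^\prec}$ is a c-space.
   Context: For a poset $(P,\le)$, $\mathord{\uparrow}X=\{x\mid \exists y\in X,\ y\le x\}$. A subset is directed if nonempty and every finite subset has an upper bound in it. An auxiliary relation on $P$ is a binary relation $\prec$ such that: $x\prec y$ implies $x\le y$; $u\le x\prec y\le z$ implies $u\prec z$; if $P$ has a least element $\bot$ then $\bot\prec x$ for all $x$. Write $s_\prec(x)=\{y\mid y\prec x\}$; $\prec$ is pre-approximating if every $s_\prec(x)$ is directed, and approximating if moreover $\bigvee s_\prec(x)=x$ for all $x$. For $A\subseteq P$, $A^{\downarrow\prec}=\{x\in A\mid s_\prec(x)\cap A\ne\emptyset\}$. $U\subseteq P$ is $\prec$-open if $U=\mathord{\uparrow}U$ and $U=U^{\downarrow\prec}$; the $\prec$-open sets form a topology $\mu^\prec(P)$. A c-space is a topological space $X$ such that for every $x\in X$ and every open $U\ni x$ there is $y\in U$ with $x\in\operatorname{int}(\mathord{\uparrow}y)$, where $\mathord{\uparrow}y$ is taken in the specialization order (which here is $\le$).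
   Formalization: In (1) it is additionally assumed that the specialization order of the ≺-open topology equals ≤; without it (1) fails, e.g. P={a<b} with only a≺a and a≺b. Given this assumption the c-space hypothesis in (1) is not needed. *)

theory Defs
  imports "HOL-Analysis.Abstract_Topology" "HOL-Library.Lub_Glb"
begin

definition upset :: "'a::order set \<Rightarrow> 'a set" where
  "upset X = {x. \<exists>y\<in>X. y \<le> x}"

definition directed_set :: "'a::order set \<Rightarrow> bool" where
  "directed_set D \<longleftrightarrow> D \<noteq> {} \<and> (\<forall>F. finite F \<and> F \<subseteq> D \<longrightarrow> (\<exists>d\<in>D. \<forall>x\<in>F. x \<le> d))"

definition auxiliary_rel :: "('a::order \<Rightarrow> 'a \<Rightarrow> bool) \<Rightarrow> bool" where
  "auxiliary_rel r \<longleftrightarrow>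
     (\<forall>x y. r x y \<longrightarrow> x \<le> y) \<and>
     (\<forall>u x y z. u \<le> x \<and> r x y \<and> y \<le> z \<longrightarrow> r u z) \<and>
     (\<forall>b. (\<forall>y. b \<le> y) \<longrightarrow> (\<forall>x. r b x))"

definition below_set :: "('a::order \<Rightarrow> 'a \<Rightarrow> bool) \<Rightarrow> 'a \<Rightarrow> 'a set" where
  "below_set r x = {y. r y x}"

definition pre_approximating :: "('a::order \<Rightarrow> 'a \<Rightarrow> bool) \<Rightarrow> bool" where
  "pre_approximating r \<longleftrightarrow> (\<forall>x. directed_set (below_set r x))"

definition approximating :: "('a::order \<Rightarrow> 'a \<Rightarrow> bool) \<Rightarrow> bool" where
  "approximating r \<longleftrightarrow> pre_approximating r \<and> (\<forall>x. isLub UNIV (below_set r x) x)"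

definition interpolation_property :: "('a::order \<Rightarrow> 'a \<Rightarrow> bool) \<Rightarrow> bool" where
  "interpolation_property r \<longleftrightarrow> (\<forall>x z. r x z \<longrightarrow> (\<exists>y. r x y \<and> r y z))"

definition down_part :: "('a::order \<Rightarrow> 'a \<Rightarrow> bool) \<Rightarrow> 'a set \<Rightarrow> 'a set" where
  "down_part r A = {x\<in>A. below_set r x \<inter> A \<noteq> {}}"

definition rel_open :: "('a::order \<Rightarrow> 'a \<Rightarrow> bool) \<Rightarrow> 'a set \<Rightarrow> bool" where
  "rel_open r U \<longleftrightarrow> U = upset U \<and> U = down_part r U"

text \<open>The value is meaningful only if the sets \<^term>\<open>rel_open r\<close> form a topology, as they do for a
  pre-approximating auxiliary relation (\<open>openin_mu_topology\<close> below).\<close>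

definition mu_topology :: "('a::order \<Rightarrow> 'a \<Rightarrow> bool) \<Rightarrow> 'a topology" where
  "mu_topology r = topology (rel_open r)"

text \<open>Convention: \<open>x\<close> is below \<open>y\<close> iff \<open>x\<close> lies in the closure of \<open>y\<close>.\<close>

definition specialization :: "'a topology \<Rightarrow> 'a \<Rightarrow> 'a \<Rightarrow> bool" where
  "specialization T x y \<longleftrightarrow> y \<in> topspace T \<and> x \<in> T closure_of {y}"

definition c_space :: "'a topology \<Rightarrow> bool" where
  "c_space T \<longleftrightarrow>
     (\<forall>U x. openin T U \<and> x \<in> U \<longrightarrow>
        (\<exists>y\<in>U. x \<in> T interior_of {z. specialization T y z}))"

lemma rel_open_iff:
  "rel_open r U \<longleftrightarrow> (\<forall>x\<in>U. (\<forall>y. x \<le> y \<longrightarrow> y \<in> U) \<and> (\<exists>y\<in>U. r y x))"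
proof
  assume U: "rel_open r U"
  then have up: "U = upset U" and dp: "U = down_part r U" by (simp_all add: rel_open_def)
  show "\<forall>x\<in>U. (\<forall>y. x \<le> y \<longrightarrow> y \<in> U) \<and> (\<exists>y\<in>U. r y x)"
  proof (intro ballI conjI allI impI)
    fix x y assume "x \<in> U" "x \<le> y"
    then have "y \<in> upset U" by (auto simp: upset_def)
    then show "y \<in> U" using up by simp
  next
    fix x assume "x \<in> U"
    then have "x \<in> down_part r U" using dp by simp
    then show "\<exists>y\<in>U. r y x" by (auto simp: down_part_def below_set_def)
  qed
next
  assume "\<forall>x\<in>U. (\<forall>y. x \<le> y \<longrightarrow> y \<in> U) \<and> (\<exists>y\<in>U. r y x)"
  then show "rel_open r U"
    unfolding rel_open_def upset_def down_part_def below_set_def by auto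
qed

lemma istopology_rel_open:
  assumes aux: "auxiliary_rel r" and pre: "pre_approximating r"
  shows "istopology (rel_open r)"
  unfolding istopology_def
proof (intro conjI allI impI)
  fix S T assume S: "rel_open r S" and T: "rel_open r T"
  show "rel_open r (S \<inter> T)"
    unfolding rel_open_iff
  proof (intro ballI conjI allI impI)
    fix x y assume "x \<in> S \<inter> T" "x \<le> y"
    then show "y \<in> S \<inter> T" using S T unfolding rel_open_iff by blast
  next
    fix x assume "x \<in> S \<inter> T"
    then obtain a b where ab: "a \<in> S" "r a x" "b \<in> T" "r b x"
      using S T unfolding rel_open_iff by blast
    have "finite {a, b} \<and> {a, b} \<subseteq> below_set r x"
      using ab by (simp add: below_set_def)
    then obtain d where d: "d \<in> below_set r x" "\<forall>z\<in>{a, b}. z \<le> d"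
      using pre unfolding pre_approximating_def directed_set_def by meson
    then have "a \<le> d" "b \<le> d" by simp_all
    then have "d \<in> S \<inter> T" using ab S T unfolding rel_open_iff by blast
    then show "\<exists>y\<in>S \<inter> T. r y x" using d(1) unfolding below_set_def by blast
  qed
next
  fix K assume "\<forall>k\<in>K. rel_open r k"
  then show "rel_open r (\<Union>K)" unfolding rel_open_iff by blast
qed

lemma openin_mu_topology:
  assumes "auxiliary_rel r" and "pre_approximating r"
  shows "openin (mu_topology r) = rel_open r"
  unfolding mu_topology_def using istopology_rel_open[OF assms] by (rule topology_inverse')

lemma topspace_mu_topology:
  assumes "auxiliary_rel r" and "pre_approximating r"
  shows "topspace (mu_topology r) = UNIV"
proof -
  have "rel_open r UNIV"
    using assms(2)
    unfolding rel_open_iff pre_approximating_def directed_set_def below_set_def by blast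
  then show ?thesis
    using openin_subset[of "mu_topology r" UNIV] openin_mu_topology[OF assms] by auto
qed

end

theory Submission
  imports Defs
begin

text \<open>An open set around \<open>x\<close> contains some z \<prec> x together with everything
  above z. Hence every upper bound u of s(x) lies in all open sets around \<open>x\<close>, so
  \<open>x\<close> is below u in the specialization order; when that order is \<le>,
  \<open>x\<close> is the least upper bound of s(x)
  (\<open>approximating_if_specialization_le\<close>). For the second part, interpolation makes each
  set of points z with y \<prec> z open (\<open>rel_open_above\<close>). Choosing y \<prec> x inside
  a given open set around \<open>x\<close>, this set is an open neighbourhood of \<open>x\<close>
  within the up-set of y (\<open>c_space_mu_topology\<close>).\<close>

lemma specialization_mu_topology_iff:
  assumes "auxiliary_rel r" and "pre_approximating r"
  shows "specialization (mu_topology r) x y \<longleftrightarrow> (\<forall>U. rel_open r U \<and> x \<in> U \<longrightarrow> y \<in> U)"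
  unfolding specialization_def in_closure_of
  by (auto simp: topspace_mu_topology[OF assms] openin_mu_topology[OF assms])

lemma approximating_if_specialization_le:
  assumes aux: "auxiliary_rel r" and pre: "pre_approximating r"
    and spec: "\<And>x y. specialization (mu_topology r) x y \<Longrightarrow> x \<le> y"
  shows "approximating r"
  unfolding approximating_def
proof (intro conjI pre allI)
  fix x
  have "x \<le> u" if u: "\<And>z. r z x \<Longrightarrow> z \<le> u" for u
  proof (rule spec)
    \<comment> \<open>\<open>U\<close> contains some z \<prec> x; then z \<le> u by the choice of
      \<open>u\<close>, and \<open>U\<close> is upward closed.\<close>
    have "u \<in> U" if "rel_open r U" "x \<in> U" for U
      using that u unfolding rel_open_iff by meson
    then show "specialization (mu_topology r) x u"
      by (simp add: specialization_mu_topology_iff[OF aux pre])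
  qed
  moreover have "z \<le> x" if "r z x" for z
    using aux that unfolding auxiliary_rel_def by metis
  ultimately show "isLub UNIV (below_set r x) x"
    by (simp add: isLub_def leastP_def isUb_def setle_def setge_def below_set_def)
qed

text \<open>Upward closure is an axiom of auxiliary relations; that each point of the set has a
  \<prec>-predecessor in the set is precisely interpolation.\<close>

lemma rel_open_above:
  assumes "auxiliary_rel r" and "interpolation_property r"
  shows "rel_open r {z. r y z}"
  unfolding rel_open_iff
proof (intro ballI conjI allI impI)
  fix x z assume "x \<in> {z. r y z}" "x \<le> z"
  then show "z \<in> {z. r y z}"
    using assms(1) unfolding auxiliary_rel_def by (metis mem_Collect_eq order_refl)
next
  fix x assume "x \<in> {z. r y z}"
  then show "\<exists>w\<in>{z. r y z}. r w x"
    using assms(2) unfolding interpolation_property_def by blast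
qed

lemma c_space_mu_topology:
  assumes aux: "auxiliary_rel r" and pre: "pre_approximating r"
    and ip: "interpolation_property r"
  shows "c_space (mu_topology r)"
  unfolding c_space_def openin_mu_topology[OF aux pre]
proof (intro allI impI)
  fix U x assume "rel_open r U \<and> x \<in> U"
  then obtain y where y: "y \<in> U" "r y x"
    unfolding rel_open_iff by blast
  \<comment> \<open>Open sets are upward closed, so y \<le> z already puts \<open>y\<close> below
    \<open>z\<close> in the specialization order.\<close>
  have "{z. r y z} \<subseteq> {z. specialization (mu_topology r) y z}"
  proof clarify
    fix z assume "r y z"
    then have "y \<le> z"
      using aux unfolding auxiliary_rel_def by metis
    then show "specialization (mu_topology r) y z"
      unfolding specialization_mu_topology_iff[OF aux pre] rel_open_iff by metis
  qed
  then have "{z. r y z} \<subseteq> mu_topology r interior_of {z. specialization (mu_topology r) y z}"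
    using rel_open_above[OF aux ip]
    by (simp add: interior_of_maximal openin_mu_topology[OF aux pre])
  then show "\<exists>y\<in>U. x \<in> mu_topology r interior_of {z. specialization (mu_topology r) y z}"
    using y by blast
qed

theorem theorem4p4:
  fixes prec :: "'a::order \<Rightarrow> 'a \<Rightarrow> bool"
  assumes aux: "auxiliary_rel prec"
    and pre: "pre_approximating prec"
  shows "((\<forall>x y. specialization (mu_topology prec) x y \<longleftrightarrow> x \<le> y) \<and> c_space (mu_topology prec)
            \<longrightarrow> approximating prec)
       \<and> (interpolation_property prec \<longrightarrow> c_space (mu_topology prec))"
  using approximating_if_specialization_le[OF aux pre] c_space_mu_topology[OF aux pre] by blast

end
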